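(* Arrow algebras as objects, implicative morphisms as morphisms (with composition of functions and identity functions), and the relation $\vdash$ on implicative morphisms as the ordering of each hom-set, form a preorder-enriched category $\mathsf{ArrAlg}$.
   Context: An arrow algebra $\mathcal A=(A,\preccurlyeq,\to,S)$ consists of a poset $(A,\preccurlyeq)$ with all meets $\bigwedge$ (top $\top$, bottom $\bot$); a binary operation $\to$ on $A$ (bracketed to the right), antitone in the first and monotone in the second argument; and a subset $S\subseteq A$ (the separator) which is upward closed, closed under modus ponens ($a\to b\in S$ and $a\in S$ imply $b\in S$), and contains the combinators $\mathbf k=\bigwedge_{a,b}a\to b\to a$, $\mathbf s=\bigwedge_{a,b,c}(a\to b\to c)\to(a\to b)\to a\to c$, and $\mathbf a=\bigwedge_{a,(b_i)_{i\in I},(c_i)_{i\in I}}\big(\bigwedge_{i\in I}a\to b_i\to c_i\big)\to a\to\bigwedge_{i\in I}(b_i\to c_i)$. An implicative morphism $f:\mathcal A\to\mathcal B$ from $\mathcal A=(A,\preccurlyeq,\to,S_A)$ to $\mathcal B=(B,\preccurlyeq,\to,S_B)$ is a function $f:A\to B$ such that: (i) $f(a)\in S_B$ for every $a\in S_A$; (ii) there is $r\in S_B$ with $r\preccurlyeq f(a\to a')\to f(a)\to f(a')$ for all $a,a'\in A$; (iii) for every $X\subseteq A\times A$, if $\bigwedge_{(a,a')\in X}a\to a'\in S_A$ then $\bigwedge_{(a,a')\in X}f(a)\to f(a')\in S_B$. For implicative morphisms $f,f':\mathcal A\to\mathcal B$, write $f\vdash f'$ if there is $u\in S_B$ with $u\preccurlyeq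 f(a)\to f'(a)$ for all $a\in A$, i.e. $\bigwedge_{a\in A}f(a)\to f'(a)\in S_B$. A preorder-enriched category is a category whose hom-sets are preordered sets and whose composition is monotone in both arguments. *)

theory Defs
  imports "HOL-Algebra.Complete_Lattice"
begin

section \<open>Arrow algebras\<close>

record 'a arrow_structure = "'a gorder" +
  arr :: "'a \<Rightarrow> 'a \<Rightarrow> 'a" (infixr \<open>\<leadsto>\<index>\<close> 65)
  separator :: "'a set"

definition comb_k :: "('a, 'm) arrow_structure_scheme \<Rightarrow> 'a" where
  "comb_k A = \<Sqinter>\<^bsub>A\<^esub> {a \<leadsto>\<^bsub>A\<^esub> b \<leadsto>\<^bsub>A\<^esub> a | a b. a \<in> carrier A \<and> b \<in> carrier A}"

definition comb_s :: "('a, 'm) arrow_structure_scheme \<Rightarrow> 'a" where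
  "comb_s A = \<Sqinter>\<^bsub>A\<^esub> {(a \<leadsto>\<^bsub>A\<^esub> b \<leadsto>\<^bsub>A\<^esub> c) \<leadsto>\<^bsub>A\<^esub> (a \<leadsto>\<^bsub>A\<^esub> b) \<leadsto>\<^bsub>A\<^esub> a \<leadsto>\<^bsub>A\<^esub> c | a b c.
     a \<in> carrier A \<and> b \<in> carrier A \<and> c \<in> carrier A}"

definition comb_a_term ::
  "('a, 'm) arrow_structure_scheme \<Rightarrow> 'a \<Rightarrow> 'i set \<Rightarrow> ('i \<Rightarrow> 'a) \<Rightarrow> ('i \<Rightarrow> 'a) \<Rightarrow> 'a" where
  "comb_a_term A a I b c =
     (IINF\<^bsub>A\<^esub> i:I. a \<leadsto>\<^bsub>A\<^esub> b i \<leadsto>\<^bsub>A\<^esub> c i) \<leadsto>\<^bsub>A\<^esub> a \<leadsto>\<^bsub>A\<^esub> (IINF\<^bsub>A\<^esub> i:I. b i \<leadsto>\<^bsub>A\<^esub> c i)"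

text \<open>The index sets of the families in the combinator \<open>\<a>\<close> are arbitrary; HOL requires fixing
  the type they range over. Sets of pairs of elements suffice: by \<open>comb_a_terms_any_index\<close>
  below, families indexed by sets of any other type contribute no further terms to the meet.\<close>

definition comb_a :: "('a, 'm) arrow_structure_scheme \<Rightarrow> 'a" where
  "comb_a A = \<Sqinter>\<^bsub>A\<^esub> {comb_a_term A a I b c | a (I :: ('a \<times> 'a) set) b c.
     a \<in> carrier A \<and> b \<in> I \<rightarrow> carrier A \<and> c \<in> I \<rightarrow> carrier A}"

lemma comb_a_terms_any_index:
  "{comb_a_term A a I b c | a (I :: 'i set) b c.
      a \<in> carrier A \<and> b \<in> I \<rightarrow> carrier A \<and> c \<in> I \<rightarrow> carrier A}
   \<subseteq> {comb_a_term A a I b c | a (I :: ('a \<times> 'a) set) b c.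
      a \<in> carrier A \<and> b \<in> I \<rightarrow> carrier A \<and> c \<in> I \<rightarrow> carrier A}"
  for A :: "('a, 'm) arrow_structure_scheme"
proof clarify
  fix a and I :: "'i set" and b c
  assume a: "a \<in> carrier A" and bc: "b \<in> I \<rightarrow> carrier A" "c \<in> I \<rightarrow> carrier A"
  let ?J = "(\<lambda>i. (b i, c i)) ` I"
  have "comb_a_term A a I b c = comb_a_term A a ?J fst snd"
    by (simp add: comb_a_term_def infi_def image_image)
  moreover have "fst \<in> ?J \<rightarrow> carrier A" "snd \<in> ?J \<rightarrow> carrier A"
    using bc by auto
  ultimately show "\<exists>a' (I' :: ('a \<times> 'a) set) b' c'.
      comb_a_term A a I b c = comb_a_term A a' I' b' c' \<and>
      a' \<in> carrier A \<and> b' \<in> I' \<rightarrow> carrier A \<and> c' \<in> I' \<rightarrow> carrier A"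
    using a by blast
qed

locale arrow_algebra = partial_order A
  for A :: "('a, 'm) arrow_structure_scheme" (structure) +
  assumes meets_exist: "X \<subseteq> carrier A \<Longrightarrow> \<exists>m. greatest A m (Lower A X)"
    and arr_closed: "a \<in> carrier A \<Longrightarrow> b \<in> carrier A \<Longrightarrow> a \<leadsto> b \<in> carrier A"
    and arr_antitone_monotone:
      "a \<in> carrier A \<Longrightarrow> a' \<in> carrier A \<Longrightarrow> b \<in> carrier A \<Longrightarrow> b' \<in> carrier A \<Longrightarrow>
       a' \<sqsubseteq> a \<Longrightarrow> b \<sqsubseteq> b' \<Longrightarrow> a \<leadsto> b \<sqsubseteq> a' \<leadsto> b'"
    and separator_subset: "separator A \<subseteq> carrier A"
    and separator_upward_closed:
      "a \<in> separator A \<Longrightarrow> b \<in> carrier A \<Longrightarrow> a \<sqsubseteq> b \<Longrightarrow> b \<in> separator A"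
    and separator_modus_ponens:
      "a \<in> carrier A \<Longrightarrow> b \<in> carrier A \<Longrightarrow>
       a \<leadsto> b \<in> separator A \<Longrightarrow> a \<in> separator A \<Longrightarrow> b \<in> separator A"
    and comb_k_in_separator: "comb_k A \<in> separator A"
    and comb_s_in_separator: "comb_s A \<in> separator A"
    and comb_a_in_separator: "comb_a A \<in> separator A"


section \<open>Implicative morphisms\<close>

text \<open>Morphisms are extensional functions (\<open>undefined\<close> outside the carrier of the domain), so
  that equality of morphisms is equality of functions on the carrier.\<close>

definition implicative_morphisms ::
  "('a, 'm) arrow_structure_scheme \<Rightarrow> ('b, 'n) arrow_structure_scheme \<Rightarrow> ('a \<Rightarrow> 'b) set" where
  "implicative_morphisms A B = {f \<in> carrier A \<rightarrow>\<^sub>E carrier B.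
     (\<forall>a \<in> separator A. f a \<in> separator B) \<and>
     (\<exists>r \<in> separator B. \<forall>a \<in> carrier A. \<forall>a' \<in> carrier A.
        r \<sqsubseteq>\<^bsub>B\<^esub> f (a \<leadsto>\<^bsub>A\<^esub> a') \<leadsto>\<^bsub>B\<^esub> f a \<leadsto>\<^bsub>B\<^esub> f a') \<and>
     (\<forall>X \<subseteq> carrier A \<times> carrier A.
        \<Sqinter>\<^bsub>A\<^esub> {a \<leadsto>\<^bsub>A\<^esub> a' | a a'. (a, a') \<in> X} \<in> separator A \<longrightarrow>
        \<Sqinter>\<^bsub>B\<^esub> {f a \<leadsto>\<^bsub>B\<^esub> f a' | a a'. (a, a') \<in> X} \<in> separator B)}"

definition implicative_le ::
  "('a, 'm) arrow_structure_scheme \<Rightarrow> ('b, 'n) arrow_structure_scheme \<Rightarrow> ('a \<Rightarrow> 'b) rel" where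
  "implicative_le A B = {(f, f').
     f \<in> implicative_morphisms A B \<and> f' \<in> implicative_morphisms A B \<and>
     (\<exists>u \<in> separator B. \<forall>a \<in> carrier A. u \<sqsubseteq>\<^bsub>B\<^esub> f a \<leadsto>\<^bsub>B\<^esub> f' a)}"


section \<open>Preorder-enriched categories\<close>

text \<open>Hom-sets are given as a family and need not be disjoint. Accordingly, composition carries
  its objects: \<open>comp A B C g f\<close> is the composite of \<open>f : A \<rightarrow> B\<close> and \<open>g : B \<rightarrow> C\<close>.\<close>

locale category =
  fixes Obj :: "'o set"
    and Hom :: "'o \<Rightarrow> 'o \<Rightarrow> 'f set"
    and ident :: "'o \<Rightarrow> 'f"
    and comp :: "'o \<Rightarrow> 'o \<Rightarrow> 'o \<Rightarrow> 'f \<Rightarrow> 'f \<Rightarrow> 'f"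
  assumes ident_in_Hom: "A \<in> Obj \<Longrightarrow> ident A \<in> Hom A A"
    and comp_in_Hom:
      "A \<in> Obj \<Longrightarrow> B \<in> Obj \<Longrightarrow> C \<in> Obj \<Longrightarrow> f \<in> Hom A B \<Longrightarrow> g \<in> Hom B C \<Longrightarrow>
       comp A B C g f \<in> Hom A C"
    and comp_ident_right:
      "A \<in> Obj \<Longrightarrow> B \<in> Obj \<Longrightarrow> f \<in> Hom A B \<Longrightarrow> comp A A B f (ident A) = f"
    and comp_ident_left:
      "A \<in> Obj \<Longrightarrow> B \<in> Obj \<Longrightarrow> f \<in> Hom A B \<Longrightarrow> comp A B B (ident B) f = f"
    and comp_assoc:
      "A \<in> Obj \<Longrightarrow> B \<in> Obj \<Longrightarrow> C \<in> Obj \<Longrightarrow> D \<in> Obj \<Longrightarrow>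
       f \<in> Hom A B \<Longrightarrow> g \<in> Hom B C \<Longrightarrow> h \<in> Hom C D \<Longrightarrow>
       comp A C D h (comp A B C g f) = comp A B D (comp B C D h g) f"

locale preorder_enriched_category = category Obj Hom ident comp
  for Obj :: "'o set"
    and Hom :: "'o \<Rightarrow> 'o \<Rightarrow> 'f set"
    and ident :: "'o \<Rightarrow> 'f"
    and comp :: "'o \<Rightarrow> 'o \<Rightarrow> 'o \<Rightarrow> 'f \<Rightarrow> 'f \<Rightarrow> 'f" +
  fixes hom_le :: "'o \<Rightarrow> 'o \<Rightarrow> 'f rel"
  assumes hom_preorder: "A \<in> Obj \<Longrightarrow> B \<in> Obj \<Longrightarrow> preorder_on (Hom A B) (hom_le A B)"
    and comp_mono:
      "A \<in> Obj \<Longrightarrow> B \<in> Obj \<Longrightarrow> C \<in> Obj \<Longrightarrow>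
       (f, f') \<in> hom_le A B \<Longrightarrow> (g, g') \<in> hom_le B C \<Longrightarrow>
       (comp A B C g f, comp A B C g' f') \<in> hom_le A C"

end

theory Submission
  imports Defs
begin

text \<open>
  Call a family of elements \<^emph>\<open>realizable\<close> if some element of the separator lies below all its
  members, which means that its meet is in the separator. The order on morphisms and all but the
  first of the conditions on an implicative morphism speak of realizability of families of
  implications. The category laws themselves are laws of functions, so the point is that identities
  and composites are implicative and that \<open>\<turnstile>\<close> is a preorder that composition respects. This
  reduces to three facts: \<open>x\<^sub>i \<leadsto> x\<^sub>i\<close> is realizable (\<open>realizable_arr_refl\<close>); if \<open>x\<^sub>i \<leadsto> y\<^sub>i\<close> and
  \<open>y\<^sub>i \<leadsto> z\<^sub>i\<close> are realizable, then so is \<open>x\<^sub>i \<leadsto> z\<^sub>i\<close> (\<open>realizable_arr_trans\<close>); and an implicative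
  morphism sends realizable families of implications to such families
  (\<open>implicative_realizable_arr\<close>).

  For a single index the first two facts are the usual derivations from \<open>\<k>\<close> and \<open>\<s>\<close>. For a family,
  modus ponens at each index puts every conclusion into the separator, but not their meet, as
  \<open>\<leadsto>\<close> need not preserve meets in its second argument. The combinator \<open>\<a>\<close> repairs this when the
  conclusions are themselves implications (\<open>realizable_modus_ponens\<close>), and in these derivations
  they always are.

  For a composite \<open>g \<circ> f\<close>, the morphism \<open>g\<close> turns the realizable family of implications from
  \<open>f (a \<leadsto> a')\<close> to \<open>f a \<leadsto> f a'\<close> into one from \<open>g (f (a \<leadsto> a'))\<close> to \<open>g (f a \<leadsto> f a')\<close>, which is then
  chained with the one from \<open>g (f a \<leadsto> f a')\<close> to \<open>g (f a) \<leadsto> g (f a')\<close>. For monotonicity of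
  composition, the implications from \<open>g (f a)\<close> to \<open>g (f' a)\<close>, obtained by applying \<open>g\<close> to \<open>f \<turnstile> f'\<close>,
  are chained with those from \<open>g (f' a)\<close> to \<open>g' (f' a)\<close>.
\<close>

section \<open>Realizable families\<close>

definition realizable ::
  "('a, 'm) arrow_structure_scheme \<Rightarrow> 'i set \<Rightarrow> ('i \<Rightarrow> 'a) \<Rightarrow> bool" where
  "realizable A I x \<longleftrightarrow> (\<exists>u \<in> separator A. \<forall>i \<in> I. u \<sqsubseteq>\<^bsub>A\<^esub> x i)"

lemma realizable_subfamily:
  "realizable A J x \<Longrightarrow> h \<in> I \<rightarrow> J \<Longrightarrow> realizable A I (\<lambda>i. x (h i))"
  unfolding realizable_def by blast

lemma realizable_reindex: "realizable A (h ` I) x \<longleftrightarrow> realizable A I (\<lambda>i. x (h i))"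
  by (simp add: realizable_def)

context arrow_algebra
begin

lemma meet_greatest:
  assumes "X \<subseteq> carrier A"
  shows "greatest A (\<Sqinter>X) (Lower A X)"
  unfolding inf_def using someI_ex[OF meets_exist[OF assms]] .

lemma meet_closed: "X \<subseteq> carrier A \<Longrightarrow> \<Sqinter>X \<in> carrier A"
  by (rule greatest_closed[OF meet_greatest])

lemma meet_lower: "X \<subseteq> carrier A \<Longrightarrow> x \<in> X \<Longrightarrow> \<Sqinter>X \<sqsubseteq> x"
  by (rule greatest_Lower_below[OF meet_greatest])

lemma meet_maximal:
  assumes "X \<subseteq> carrier A" "u \<in> carrier A" "\<And>x. x \<in> X \<Longrightarrow> u \<sqsubseteq> x"
  shows "u \<sqsubseteq> \<Sqinter>X"
  using greatest_le[OF meet_greatest[OF assms(1)]] assms by (auto simp: Lower_def)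

lemma realizable_iff_meet:
  assumes "x \<in> I \<rightarrow> carrier A"
  shows "realizable A I x \<longleftrightarrow> \<Sqinter>(x ` I) \<in> separator A"
proof
  have X: "x ` I \<subseteq> carrier A"
    using assms by auto
  show "\<Sqinter>(x ` I) \<in> separator A" if r: "realizable A I x"
  proof -
    obtain u where u: "u \<in> separator A" "\<And>i. i \<in> I \<Longrightarrow> u \<sqsubseteq> x i"
      using r unfolding realizable_def by blast
    then have "u \<sqsubseteq> \<Sqinter>(x ` I)"
      using X separator_subset by (intro meet_maximal) auto
    with u(1) show ?thesis
      using separator_upward_closed meet_closed[OF X] by blast
  qed
  show "realizable A I x" if "\<Sqinter>(x ` I) \<in> separator A"
    using that meet_lower[OF X] unfolding realizable_def by blast
qed

lemma realizable_comb_k: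
  assumes "x \<in> I \<rightarrow> carrier A" "y \<in> I \<rightarrow> carrier A"
  shows "realizable A I (\<lambda>i. x i \<leadsto> y i \<leadsto> x i)"
proof -
  have "comb_k A \<sqsubseteq> x i \<leadsto> y i \<leadsto> x i" if "i \<in> I" for i
    unfolding comb_k_def
  proof (rule meet_lower)
    show "x i \<leadsto> y i \<leadsto> x i \<in>
        {a \<leadsto> b \<leadsto> a | a b. a \<in> carrier A \<and> b \<in> carrier A}"
      using assms that by blast
  qed (auto intro!: arr_closed)
  then show ?thesis
    using comb_k_in_separator unfolding realizable_def by blast
qed

lemma realizable_comb_s:
  assumes "x \<in> I \<rightarrow> carrier A" "y \<in> I \<rightarrow> carrier A" "z \<in> I \<rightarrow> carrier A"
  shows "realizable A I (\<lambda>i. (x i \<leadsto> y i \<leadsto> z i) \<leadsto> (x i \<leadsto> y i) \<leadsto> x i \<leadsto> z i)"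
proof -
  have "comb_s A \<sqsubseteq> (x i \<leadsto> y i \<leadsto> z i) \<leadsto> (x i \<leadsto> y i) \<leadsto> x i \<leadsto> z i" if "i \<in> I" for i
    unfolding comb_s_def
  proof (rule meet_lower)
    show "(x i \<leadsto> y i \<leadsto> z i) \<leadsto> (x i \<leadsto> y i) \<leadsto> x i \<leadsto> z i \<in>
        {(a \<leadsto> b \<leadsto> c) \<leadsto> (a \<leadsto> b) \<leadsto> a \<leadsto> c | a b c.
          a \<in> carrier A \<and> b \<in> carrier A \<and> c \<in> carrier A}"
      using assms that by blast
  qed (auto intro!: arr_closed)
  then show ?thesis
    using comb_s_in_separator unfolding realizable_def by blast
qed

lemma comb_a_term_closed:
  assumes "a \<in> carrier A" "b \<in> I \<rightarrow> carrier A" "c \<in> I \<rightarrow> carrier A"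
  shows "comb_a_term A a I b c \<in> carrier A"
  unfolding comb_a_term_def infi_def
  using assms by (intro arr_closed meet_closed) (auto intro!: arr_closed)

lemma comb_a_term_in_separator:
  assumes "a \<in> carrier A" "b \<in> I \<rightarrow> carrier A" "c \<in> I \<rightarrow> carrier A"
  shows "comb_a_term A a I b c \<in> separator A"
proof -
  have "comb_a_term A a I b c \<in> {comb_a_term A a I b c | a (I :: ('a \<times> 'a) set) b c.
      a \<in> carrier A \<and> b \<in> I \<rightarrow> carrier A \<and> c \<in> I \<rightarrow> carrier A}"
    by (rule subsetD[OF comb_a_terms_any_index]) (use assms in blast)
  then have "comb_a A \<sqsubseteq> comb_a_term A a I b c"
    unfolding comb_a_def by (rule meet_lower[rotated]) (auto intro!: comb_a_term_closed)
  then show ?thesis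
    using separator_upward_closed comb_a_in_separator comb_a_term_closed[OF assms] by blast
qed


section \<open>Uniform reasoning with implications\<close>

text \<open>If \<open>a\<close> is the meet of the premises, then antitonicity weakens the implications to
  \<open>a \<leadsto> b\<^sub>i \<leadsto> c\<^sub>i\<close>, whose common premise no longer depends on \<open>i\<close>. The combinator \<open>\<a>\<close> moves the
  meet past it, and modus ponens for single elements applies.\<close>

lemma realizable_modus_ponens:
  assumes imp: "realizable A I (\<lambda>i. x i \<leadsto> b i \<leadsto> c i)" and prem: "realizable A I x"
    and closed: "x \<in> I \<rightarrow> carrier A" "b \<in> I \<rightarrow> carrier A" "c \<in> I \<rightarrow> carrier A"
  shows "realizable A I (\<lambda>i. b i \<leadsto> c i)"
proof -
  define a where "a = \<Sqinter>(x ` I)"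
  have a: "a \<in> separator A"
    using prem realizable_iff_meet[OF closed(1)] by (simp add: a_def)
  then have aA: "a \<in> carrier A"
    using separator_subset by blast
  have bc: "(\<lambda>i. b i \<leadsto> c i) \<in> I \<rightarrow> carrier A" "(\<lambda>i. a \<leadsto> b i \<leadsto> c i) \<in> I \<rightarrow> carrier A"
    using aA closed by (auto intro!: arr_closed)
  obtain u where u: "u \<in> separator A" "\<And>i. i \<in> I \<Longrightarrow> u \<sqsubseteq> x i \<leadsto> b i \<leadsto> c i"
    using imp unfolding realizable_def by blast
  have "u \<sqsubseteq> a \<leadsto> b i \<leadsto> c i" if i: "i \<in> I" for i
  proof (rule le_trans[OF u(2)[OF i]])
    have xi: "x i \<in> carrier A" "b i \<leadsto> c i \<in> carrier A"
      using closed bc i by auto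
    have "a \<sqsubseteq> x i"
      unfolding a_def using closed i by (intro meet_lower) auto
    then show "x i \<leadsto> b i \<leadsto> c i \<sqsubseteq> a \<leadsto> b i \<leadsto> c i"
      by (rule arr_antitone_monotone[OF xi(1) aA xi(2) xi(2)]) (simp add: xi)
  qed (use i u aA closed separator_subset in \<open>auto intro!: arr_closed\<close>)
  then have "realizable A I (\<lambda>i. a \<leadsto> b i \<leadsto> c i)"
    using u(1) unfolding realizable_def by blast
  then have "(IINF i:I. a \<leadsto> b i \<leadsto> c i) \<in> separator A"
    using realizable_iff_meet[OF bc(2)] by (simp add: infi_def)
  moreover have "(IINF i:I. a \<leadsto> b i \<leadsto> c i) \<leadsto> a \<leadsto> (IINF i:I. b i \<leadsto> c i) \<in> separator A"
    using comb_a_term_in_separator[OF aA closed(2,3)] by (simp add: comb_a_term_def)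
  moreover have IINF: "(IINF i:I. b i \<leadsto> c i) \<in> carrier A"
    unfolding infi_def using bc(1) by (intro meet_closed) auto
  ultimately have "a \<leadsto> (IINF i:I. b i \<leadsto> c i) \<in> separator A"
    using separator_modus_ponens separator_subset arr_closed aA by blast
  then have "(IINF i:I. b i \<leadsto> c i) \<in> separator A"
    using separator_modus_ponens aA a IINF by blast
  then show ?thesis
    using realizable_iff_meet[OF bc(1)] by (simp add: infi_def)
qed

lemma realizable_comb_s_app:
  assumes "realizable A I (\<lambda>i. x i \<leadsto> y i \<leadsto> z i)" "realizable A I (\<lambda>i. x i \<leadsto> y i)"
    and "x \<in> I \<rightarrow> carrier A" "y \<in> I \<rightarrow> carrier A" "z \<in> I \<rightarrow> carrier A"
  shows "realizable A I (\<lambda>i. x i \<leadsto> z i)"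
proof (rule realizable_modus_ponens)
  show "realizable A I (\<lambda>i. (x i \<leadsto> y i) \<leadsto> x i \<leadsto> z i)"
    by (rule realizable_modus_ponens[OF realizable_comb_s])
      (use assms in \<open>auto intro!: arr_closed\<close>)
qed (use assms in \<open>auto intro!: arr_closed\<close>)

text \<open>The derivation \<open>\<s> \<k> \<k>\<close> of the identity.\<close>

lemma realizable_arr_refl:
  assumes "x \<in> I \<rightarrow> carrier A"
  shows "realizable A I (\<lambda>i. x i \<leadsto> x i)"
proof (rule realizable_comb_s_app)
  show "realizable A I (\<lambda>i. x i \<leadsto> (x i \<leadsto> x i) \<leadsto> x i)" "realizable A I (\<lambda>i. x i \<leadsto> x i \<leadsto> x i)"
    using assms by (auto intro!: realizable_comb_k arr_closed)
qed (use assms in \<open>auto intro!: arr_closed\<close>)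

text \<open>The derivation \<open>\<s> (\<k> v) u\<close> of the composite, where \<open>u\<close> and \<open>v\<close> realize the two given
  families.\<close>

lemma realizable_arr_trans:
  assumes "realizable A I (\<lambda>i. x i \<leadsto> y i)" "realizable A I (\<lambda>i. y i \<leadsto> z i)"
    and "x \<in> I \<rightarrow> carrier A" "y \<in> I \<rightarrow> carrier A" "z \<in> I \<rightarrow> carrier A"
  shows "realizable A I (\<lambda>i. x i \<leadsto> z i)"
proof (rule realizable_comb_s_app)
  show "realizable A I (\<lambda>i. x i \<leadsto> y i \<leadsto> z i)"
    by (rule realizable_modus_ponens[OF realizable_comb_k])
      (use assms in \<open>auto intro!: arr_closed\<close>)
qed (use assms in auto)

end


section \<open>Implicative morphisms\<close>

text \<open>Stated with realizability instead of meets over sets of pairs, the conditions on a morphism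
  combine directly with the derivations above.\<close>

lemma implicative_morphisms_iff:
  assumes "arrow_algebra A" "arrow_algebra B"
  shows "f \<in> implicative_morphisms A B \<longleftrightarrow>
    f \<in> carrier A \<rightarrow>\<^sub>E carrier B \<and> (\<forall>a \<in> separator A. f a \<in> separator B) \<and>
    realizable B (carrier A \<times> carrier A)
      (\<lambda>(a, a'). f (a \<leadsto>\<^bsub>A\<^esub> a') \<leadsto>\<^bsub>B\<^esub> f a \<leadsto>\<^bsub>B\<^esub> f a') \<and>
    (\<forall>X \<subseteq> carrier A \<times> carrier A. realizable A X (\<lambda>(a, a'). a \<leadsto>\<^bsub>A\<^esub> a') \<longrightarrow>
      realizable B X (\<lambda>(a, a'). f a \<leadsto>\<^bsub>B\<^esub> f a'))"
proof -
  interpret A: arrow_algebra A by fact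
  interpret B: arrow_algebra B by fact
  have meet_A: "\<Sqinter>\<^bsub>A\<^esub> {a \<leadsto>\<^bsub>A\<^esub> a' | a a'. (a, a') \<in> X} \<in> separator A \<longleftrightarrow>
      realizable A X (\<lambda>(a, a'). a \<leadsto>\<^bsub>A\<^esub> a')" if "X \<subseteq> carrier A \<times> carrier A" for X
  proof -
    have "{a \<leadsto>\<^bsub>A\<^esub> a' | a a'. (a, a') \<in> X} = (\<lambda>(a, a'). a \<leadsto>\<^bsub>A\<^esub> a') ` X"
      by force
    then show ?thesis
      using that by (subst A.realizable_iff_meet) (auto intro!: A.arr_closed)
  qed
  have meet_B: "\<Sqinter>\<^bsub>B\<^esub> {f a \<leadsto>\<^bsub>B\<^esub> f a' | a a'. (a, a') \<in> X} \<in> separator B \<longleftrightarrow>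
      realizable B X (\<lambda>(a, a'). f a \<leadsto>\<^bsub>B\<^esub> f a')"
    if "X \<subseteq> carrier A \<times> carrier A" "f \<in> carrier A \<rightarrow>\<^sub>E carrier B" for X
  proof -
    have "{f a \<leadsto>\<^bsub>B\<^esub> f a' | a a'. (a, a') \<in> X} = (\<lambda>(a, a'). f a \<leadsto>\<^bsub>B\<^esub> f a') ` X"
      by force
    then show ?thesis
      using that by (subst B.realizable_iff_meet) (auto intro!: B.arr_closed)
  qed
  have iii: "(\<forall>X \<subseteq> carrier A \<times> carrier A.
      \<Sqinter>\<^bsub>A\<^esub> {a \<leadsto>\<^bsub>A\<^esub> a' | a a'. (a, a') \<in> X} \<in> separator A \<longrightarrow>
      \<Sqinter>\<^bsub>B\<^esub> {f a \<leadsto>\<^bsub>B\<^esub> f a' | a a'. (a, a') \<in> X} \<in> separator B) \<longleftrightarrow>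
    (\<forall>X \<subseteq> carrier A \<times> carrier A. realizable A X (\<lambda>(a, a'). a \<leadsto>\<^bsub>A\<^esub> a') \<longrightarrow>
      realizable B X (\<lambda>(a, a'). f a \<leadsto>\<^bsub>B\<^esub> f a'))" if "f \<in> carrier A \<rightarrow>\<^sub>E carrier B"
    using meet_A meet_B that by (intro all_cong) simp
  have ii: "(\<exists>r \<in> separator B. \<forall>a \<in> carrier A. \<forall>a' \<in> carrier A.
        r \<sqsubseteq>\<^bsub>B\<^esub> f (a \<leadsto>\<^bsub>A\<^esub> a') \<leadsto>\<^bsub>B\<^esub> f a \<leadsto>\<^bsub>B\<^esub> f a') \<longleftrightarrow>
    realizable B (carrier A \<times> carrier A)
      (\<lambda>(a, a'). f (a \<leadsto>\<^bsub>A\<^esub> a') \<leadsto>\<^bsub>B\<^esub> f a \<leadsto>\<^bsub>B\<^esub> f a')"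
    by (simp add: realizable_def)
  show ?thesis
    unfolding implicative_morphisms_def mem_Collect_eq ii using iii by blast
qed

text \<open>Any indexed family may replace a set of pairs, since realizability depends only on the set
  of pairs \<open>(x\<^sub>i, y\<^sub>i)\<close>.\<close>

lemma implicative_realizable_arr:
  assumes "arrow_algebra A" "arrow_algebra B" "f \<in> implicative_morphisms A B"
    and "x \<in> I \<rightarrow> carrier A" "y \<in> I \<rightarrow> carrier A"
    and "realizable A I (\<lambda>i. x i \<leadsto>\<^bsub>A\<^esub> y i)"
  shows "realizable B I (\<lambda>i. f (x i) \<leadsto>\<^bsub>B\<^esub> f (y i))"
proof -
  let ?X = "(\<lambda>i. (x i, y i)) ` I"
  have "realizable A ?X (\<lambda>(a, a'). a \<leadsto>\<^bsub>A\<^esub> a')"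
    using assms(6) by (simp add: realizable_reindex)
  moreover have "?X \<subseteq> carrier A \<times> carrier A"
    using assms by auto
  ultimately have "realizable B ?X (\<lambda>(a, a'). f a \<leadsto>\<^bsub>B\<^esub> f a')"
    using assms(1-3) by (simp add: implicative_morphisms_iff)
  then show ?thesis
    by (simp add: realizable_reindex)
qed

lemma identity_implicative:
  assumes "arrow_algebra A"
  shows "(\<lambda>x \<in> carrier A. x) \<in> implicative_morphisms A A"
proof -
  interpret arrow_algebra A by fact
  let ?id = "\<lambda>x \<in> carrier A. x"
  have "realizable A (carrier A \<times> carrier A)
      (\<lambda>p. (fst p \<leadsto>\<^bsub>A\<^esub> snd p) \<leadsto>\<^bsub>A\<^esub> fst p \<leadsto>\<^bsub>A\<^esub> snd p)"
    by (rule realizable_arr_refl) (auto intro!: arr_closed)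
  then have "realizable A (carrier A \<times> carrier A)
      (\<lambda>(a, a'). ?id (a \<leadsto>\<^bsub>A\<^esub> a') \<leadsto>\<^bsub>A\<^esub> ?id a \<leadsto>\<^bsub>A\<^esub> ?id a')"
    by (simp add: realizable_def arr_closed)
  moreover have "realizable A X (\<lambda>(a, a'). ?id a \<leadsto>\<^bsub>A\<^esub> ?id a')"
    if "X \<subseteq> carrier A \<times> carrier A" and r: "realizable A X (\<lambda>(a, a'). a \<leadsto>\<^bsub>A\<^esub> a')" for X
  proof -
    have "fst p \<in> carrier A" "snd p \<in> carrier A" if "p \<in> X" for p
      using \<open>X \<subseteq> carrier A \<times> carrier A\<close> that by auto
    then show ?thesis
      using r by (simp add: realizable_def case_prod_unfold)
  qed
  moreover have "?id \<in> carrier A \<rightarrow>\<^sub>E carrier A"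
    by simp
  moreover have "?id a \<in> separator A" if "a \<in> separator A" for a
    using that separator_subset by auto
  ultimately show ?thesis
    unfolding implicative_morphisms_iff[OF assms assms] by blast
qed

lemma compose_implicative:
  assumes algs: "arrow_algebra A" "arrow_algebra B" "arrow_algebra C"
    and f: "f \<in> implicative_morphisms A B" and g: "g \<in> implicative_morphisms B C"
  shows "compose (carrier A) g f \<in> implicative_morphisms A C"
proof -
  interpret A: arrow_algebra A by fact
  interpret B: arrow_algebra B by fact
  interpret C: arrow_algebra C by fact
  let ?h = "compose (carrier A) g f"
  have fE: "f \<in> carrier A \<rightarrow>\<^sub>E carrier B" and gE: "g \<in> carrier B \<rightarrow>\<^sub>E carrier C"
    and fS: "\<And>a. a \<in> separator A \<Longrightarrow> f a \<in> separator B"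
    and gS: "\<And>b. b \<in> separator B \<Longrightarrow> g b \<in> separator C"
    and f_arr: "realizable B (carrier A \<times> carrier A)
      (\<lambda>(a, a'). f (a \<leadsto>\<^bsub>A\<^esub> a') \<leadsto>\<^bsub>B\<^esub> f a \<leadsto>\<^bsub>B\<^esub> f a')"
    and g_arr: "realizable C (carrier B \<times> carrier B)
      (\<lambda>(b, b'). g (b \<leadsto>\<^bsub>B\<^esub> b') \<leadsto>\<^bsub>C\<^esub> g b \<leadsto>\<^bsub>C\<^esub> g b')"
    using f g algs by (auto simp: implicative_morphisms_iff)
  have fc: "f a \<in> carrier B" if "a \<in> carrier A" for a
    using fE that by auto
  have gc: "g b \<in> carrier C" if "b \<in> carrier B" for b
    using gE that by auto
  note closed = A.arr_closed B.arr_closed C.arr_closed fc gc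
  let ?I = "carrier A \<times> carrier A"
  have "realizable C ?I
      (\<lambda>p. g (f (fst p \<leadsto>\<^bsub>A\<^esub> snd p)) \<leadsto>\<^bsub>C\<^esub> g (f (fst p) \<leadsto>\<^bsub>B\<^esub> f (snd p)))"
    by (rule implicative_realizable_arr[OF algs(2,3) g])
      (use f_arr in \<open>auto intro!: closed simp: case_prod_unfold\<close>)
  moreover have "realizable C ?I (\<lambda>p. g (f (fst p) \<leadsto>\<^bsub>B\<^esub> f (snd p)) \<leadsto>\<^bsub>C\<^esub>
      g (f (fst p)) \<leadsto>\<^bsub>C\<^esub> g (f (snd p)))"
    using realizable_subfamily[OF g_arr, of "\<lambda>p. (f (fst p), f (snd p))" ?I] fc
    by (simp add: Pi_iff mem_Times_iff)
  ultimately have "realizable C ?I (\<lambda>p. g (f (fst p \<leadsto>\<^bsub>A\<^esub> snd p)) \<leadsto>\<^bsub>C\<^esub>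
      g (f (fst p)) \<leadsto>\<^bsub>C\<^esub> g (f (snd p)))"
    by (rule C.realizable_arr_trans) (auto intro!: closed)
  then have "realizable C ?I (\<lambda>(a, a'). ?h (a \<leadsto>\<^bsub>A\<^esub> a') \<leadsto>\<^bsub>C\<^esub> ?h a \<leadsto>\<^bsub>C\<^esub> ?h a')"
    by (simp add: realizable_def compose_eq A.arr_closed)
  moreover have "realizable C X (\<lambda>(a, a'). ?h a \<leadsto>\<^bsub>C\<^esub> ?h a')"
    if X: "X \<subseteq> ?I" and r: "realizable A X (\<lambda>(a, a'). a \<leadsto>\<^bsub>A\<^esub> a')" for X
  proof -
    have mem: "fst p \<in> carrier A" "snd p \<in> carrier A" if "p \<in> X" for p
      using X that by auto
    have "realizable B X (\<lambda>p. f (fst p) \<leadsto>\<^bsub>B\<^esub> f (snd p))"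
      by (rule implicative_realizable_arr[OF algs(1,2) f])
        (use r mem in \<open>auto simp: case_prod_unfold\<close>)
    then have "realizable C X (\<lambda>p. g (f (fst p)) \<leadsto>\<^bsub>C\<^esub> g (f (snd p)))"
      by (intro implicative_realizable_arr[OF algs(2,3) g]) (auto intro!: fc mem)
    then show ?thesis
      using mem by (simp add: realizable_def compose_eq case_prod_beta)
  qed
  moreover have "?h \<in> carrier A \<rightarrow>\<^sub>E carrier C"
    by (auto simp: compose_def fc gc)
  moreover have "?h a \<in> separator C" if "a \<in> separator A" for a
    using that fS gS A.separator_subset by (auto simp: compose_eq)
  ultimately show ?thesis
    using algs by (simp add: implicative_morphisms_iff)
qed


section \<open>The order on implicative morphisms\<close>

lemma implicative_le_iff:
  "(f, f') \<in> implicative_le A B \<longleftrightarrow>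
    f \<in> implicative_morphisms A B \<and> f' \<in> implicative_morphisms A B \<and>
    realizable B (carrier A) (\<lambda>a. f a \<leadsto>\<^bsub>B\<^esub> f' a)"
  by (simp add: implicative_le_def realizable_def)

lemma implicative_morphism_closed:
  "f \<in> implicative_morphisms A B \<Longrightarrow> f \<in> carrier A \<rightarrow> carrier B"
  unfolding implicative_morphisms_def PiE_def by blast

lemma implicative_morphism_extensional:
  "f \<in> implicative_morphisms A B \<Longrightarrow> f \<in> extensional (carrier A)"
  unfolding implicative_morphisms_def PiE_def by blast

lemma implicative_le_preorder:
  assumes "arrow_algebra B"
  shows "preorder_on (implicative_morphisms A B) (implicative_le A B)"
proof -
  interpret arrow_algebra B by fact
  have "implicative_le A B \<subseteq> implicative_morphisms A B \<times> implicative_morphisms A B"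
    by (auto simp: implicative_le_iff)
  moreover have "refl_on (implicative_morphisms A B) (implicative_le A B)"
    by (simp add: refl_on_def implicative_le_iff realizable_arr_refl implicative_morphism_closed)
  moreover have "trans (implicative_le A B)"
  proof (rule transI)
    fix f g h
    assume le: "(f, g) \<in> implicative_le A B" "(g, h) \<in> implicative_le A B"
    have "realizable B (carrier A) (\<lambda>a. f a \<leadsto>\<^bsub>B\<^esub> h a)"
    proof (rule realizable_arr_trans)
      show "realizable B (carrier A) (\<lambda>a. f a \<leadsto>\<^bsub>B\<^esub> g a)"
        "realizable B (carrier A) (\<lambda>a. g a \<leadsto>\<^bsub>B\<^esub> h a)"
        using le by (simp_all add: implicative_le_iff)
      show "f \<in> carrier A \<rightarrow> carrier B" "g \<in> carrier A \<rightarrow> carrier B"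
        "h \<in> carrier A \<rightarrow> carrier B"
        using le by (simp_all add: implicative_le_iff implicative_morphism_closed)
    qed
    with le show "(f, h) \<in> implicative_le A B"
      by (simp add: implicative_le_iff)
  qed
  ultimately show ?thesis
    by (simp add: preorder_on_def)
qed

lemma implicative_le_compose_mono:
  assumes algs: "arrow_algebra A" "arrow_algebra B" "arrow_algebra C"
    and "(f, f') \<in> implicative_le A B" "(g, g') \<in> implicative_le B C"
  shows "(compose (carrier A) g f, compose (carrier A) g' f') \<in> implicative_le A C"
proof -
  interpret C: arrow_algebra C by fact
  have f: "f \<in> implicative_morphisms A B" "f' \<in> implicative_morphisms A B"
      "realizable B (carrier A) (\<lambda>a. f a \<leadsto>\<^bsub>B\<^esub> f' a)"
    and g: "g \<in> implicative_morphisms B C" "g' \<in> implicative_morphisms B C"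
      "realizable C (carrier B) (\<lambda>b. g b \<leadsto>\<^bsub>C\<^esub> g' b)"
    using assms by (auto simp: implicative_le_iff)
  note closed = f(1,2)[THEN implicative_morphism_closed] g(1,2)[THEN implicative_morphism_closed]
  have "realizable C (carrier A) (\<lambda>a. g (f a) \<leadsto>\<^bsub>C\<^esub> g (f' a))"
    by (rule implicative_realizable_arr[OF algs(2,3) g(1) closed(1,2) f(3)])
  moreover have "realizable C (carrier A) (\<lambda>a. g (f' a) \<leadsto>\<^bsub>C\<^esub> g' (f' a))"
    by (rule realizable_subfamily[OF g(3) closed(2)])
  ultimately have "realizable C (carrier A) (\<lambda>a. g (f a) \<leadsto>\<^bsub>C\<^esub> g' (f' a))"
    by (rule C.realizable_arr_trans) (use closed in auto)
  then have "realizable C (carrier A)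
      (\<lambda>a. compose (carrier A) g f a \<leadsto>\<^bsub>C\<^esub> compose (carrier A) g' f' a)"
    by (simp add: realizable_def compose_eq)
  then show ?thesis
    using compose_implicative[OF algs f(1) g(1)] compose_implicative[OF algs f(2) g(2)]
    by (simp add: implicative_le_iff)
qed


section \<open>The category of arrow algebras\<close>

theorem proposition3p4:
  shows "preorder_enriched_category
    {A :: 'a arrow_structure. arrow_algebra A}
    implicative_morphisms
    (\<lambda>A. \<lambda>x \<in> carrier A. x)
    (\<lambda>A B C g f. compose (carrier A) g f)
    implicative_le"
proof
  fix A B :: "'a arrow_structure" and f
  assume f: "f \<in> implicative_morphisms A B"
  note fE = implicative_morphism_closed[OF f] implicative_morphism_extensional[OF f]
  show "compose (carrier A) f (\<lambda>x \<in> carrier A. x) = f"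
    by (rule compose_Id[OF fE])
  show "compose (carrier A) (\<lambda>x \<in> carrier B. x) f = f"
    by (rule Id_compose[OF fE])
next
  fix A B C D :: "'a arrow_structure" and f g h :: "'a \<Rightarrow> 'a"
  assume "f \<in> implicative_morphisms A B"
  then show "compose (carrier A) h (compose (carrier A) g f) =
      compose (carrier A) (compose (carrier B) h g) f"
    by (rule compose_assoc[OF implicative_morphism_closed])
next
  fix A B C :: "'a arrow_structure" and f g :: "'a \<Rightarrow> 'a"
  assume "A \<in> {A. arrow_algebra A}" "B \<in> {A. arrow_algebra A}" "C \<in> {A. arrow_algebra A}"
    and "f \<in> implicative_morphisms A B" "g \<in> implicative_morphisms B C"
  then show "compose (carrier A) g f \<in> implicative_morphisms A C"
    using compose_implicative by blast
next
  fix A B C :: "'a arrow_structure" and f f' g g' :: "'a \<Rightarrow> 'a"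
  assume "A \<in> {A. arrow_algebra A}" "B \<in> {A. arrow_algebra A}" "C \<in> {A. arrow_algebra A}"
    and "(f, f') \<in> implicative_le A B" "(g, g') \<in> implicative_le B C"
  then show "(compose (carrier A) g f, compose (carrier A) g' f') \<in> implicative_le A C"
    using implicative_le_compose_mono by blast
qed (simp_all add: identity_implicative implicative_le_preorder)

end
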